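(* The elliptic Artin monoids $M'(\tilde{D}_4^{(1,1)})$ and $M'(\tilde{E}_n^{(1,1)})$, for $n=6,7,8$, are cancellative.
   Context: A monoid $M$ is cancellative if, for all $u,v,v',w\in M$, $uvw=uv'w$ implies $v=v'$. $M'(\tilde{D}_4^{(1,1)})$ is the monoid defined by the monoid presentation with generators $t_i$ ($i\in\mathbb{Z}$), $s_1,s_2,s_3,s_4$ and relations: $t_is_jt_i=s_jt_is_j$ for $i\in\mathbb{Z}$, $j=1,2,3,4$; $s_is_j=s_js_i$ for $i\neq j$ in $\{1,2,3,4\}$; $t_it_{i-1}=t_jt_{j-1}$ for $i,j\in\mathbb{Z}$. For $n\in\{6,7,8\}$, let $E_6=\{\{1,4\},\{2,5\},\{3,6\}\}$, $E_7=\{\{2,4\},\{4,5\},\{3,6\},\{6,7\}\}$, $E_8=\{\{2,4\},\{3,5\},\{5,6\},\{6,7\},\{7,8\}\}$. $M'(\tilde{E}_n^{(1,1)})$ is the monoid defined by the monoid presentation with generators $t_i$ ($i\in\mathbb{Z}$), $s_1,\dots,s_n$ and relations: $t_is_jt_i=s_jt_is_j$ for $i\in\mathbb{Z}$, $j=1,2,3$; $t_is_j=s_jt_i$ for $i\in\mathbb{Z}$, $4\le j\le n$; $t_it_{i-1}=t_jt_{j-1}$ for $i,j\in\mathbb{Z}$; and for $1\le j<k\le n$, $s_js_ks_j=s_ks_js_k$ if $\{j,k\}\in E_n$ and $s_js_k=s_ks_j$ if $\{j,k\}\notin E_n$. *)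

theory Defs
  imports "HOL-Algebra.Divisibility"
begin

section \<open>Cancellative monoids\<close>

locale cancellative_monoid = monoid M for M (structure) +
  assumes cancel:
    "\<lbrakk> u \<in> carrier M; v \<in> carrier M; v' \<in> carrier M; w \<in> carrier M;
       u \<otimes> v \<otimes> w = u \<otimes> v' \<otimes> w \<rbrakk> \<Longrightarrow> v = v'"

lemma cancellative_monoid_iff_monoid_cancel:
  "cancellative_monoid M \<longleftrightarrow> monoid_cancel M"
proof
  assume "cancellative_monoid M"
  then interpret cancellative_monoid M .
  show "monoid_cancel M"
  proof (rule monoid_cancelI)
    fix a b c
    assume abc: "a \<in> carrier M" "b \<in> carrier M" "c \<in> carrier M"
    show "a = b" if "c \<otimes>\<^bsub>M\<^esub> a = c \<otimes>\<^bsub>M\<^esub> b"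
      using cancel[of c a b "\<one>\<^bsub>M\<^esub>"] abc that by simp
    show "a = b" if "a \<otimes>\<^bsub>M\<^esub> c = b \<otimes>\<^bsub>M\<^esub> c"
      using cancel[of "\<one>\<^bsub>M\<^esub>" a b c] abc that by simp
  qed
next
  assume "monoid_cancel M"
  then interpret monoid_cancel M .
  show "cancellative_monoid M"
  proof
    fix u v v' w
    assume c: "u \<in> carrier M" "v \<in> carrier M" "v' \<in> carrier M" "w \<in> carrier M"
      and eq: "u \<otimes>\<^bsub>M\<^esub> v \<otimes>\<^bsub>M\<^esub> w = u \<otimes>\<^bsub>M\<^esub> v' \<otimes>\<^bsub>M\<^esub> w"
    have "u \<otimes>\<^bsub>M\<^esub> v = u \<otimes>\<^bsub>M\<^esub> v'"
      using r_cancel[OF eq] c by simp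
    then show "v = v'"
      using l_cancel c by blast
  qed
qed


section \<open>Monoid presentations\<close>

text \<open>
  For a set \<open>A\<close> of generators and a set \<open>R\<close> of pairs of words, \<open>pres_cong A R\<close> is the smallest
  congruence on the free monoid \<open>lists A\<close> that contains those pairs of \<open>R\<close> whose components
  are words over \<open>A\<close>.
\<close>

inductive_set pres_cong :: "'a set \<Rightarrow> ('a list \<times> 'a list) set \<Rightarrow> ('a list \<times> 'a list) set"
  for A :: "'a set" and R :: "('a list \<times> 'a list) set"
where
  rel: "\<lbrakk> (x, y) \<in> R; x \<in> lists A; y \<in> lists A \<rbrakk> \<Longrightarrow> (x, y) \<in> pres_cong A R"
| refl: "x \<in> lists A \<Longrightarrow> (x, x) \<in> pres_cong A R"
| sym: "(x, y) \<in> pres_cong A R \<Longrightarrow> (y, x) \<in> pres_cong A R"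
| trans: "\<lbrakk> (x, y) \<in> pres_cong A R; (y, z) \<in> pres_cong A R \<rbrakk> \<Longrightarrow> (x, z) \<in> pres_cong A R"
| append: "\<lbrakk> (x, y) \<in> pres_cong A R; (x', y') \<in> pres_cong A R \<rbrakk>
    \<Longrightarrow> (x @ x', y @ y') \<in> pres_cong A R"

definition presented_monoid :: "'a set \<Rightarrow> ('a list \<times> 'a list) set \<Rightarrow> 'a list set monoid" where
  "presented_monoid A R =
     \<lparr> carrier = lists A // pres_cong A R,
       mult = (\<lambda>X Y. \<Union>x\<in>X. \<Union>y\<in>Y. pres_cong A R `` {x @ y}),
       one = pres_cong A R `` {[]} \<rparr>"

lemma pres_cong_in_lists:
  "(x, y) \<in> pres_cong A R \<Longrightarrow> x \<in> lists A \<and> y \<in> lists A"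
  by (induction rule: pres_cong.induct) auto

lemma equiv_pres_cong: "equiv (lists A) (pres_cong A R)"
proof (rule equivI)
  show "pres_cong A R \<subseteq> lists A \<times> lists A"
    using pres_cong_in_lists by fastforce
  show "refl_on (lists A) (pres_cong A R)"
    by (auto intro!: refl_onI pres_cong.refl)
  show "Relation.sym (pres_cong A R)"
    by (auto intro: symI pres_cong.sym)
  show "Relation.trans (pres_cong A R)"
    by (auto intro: transI pres_cong.trans)
qed

lemma presented_monoid_mult_class:
  assumes "x \<in> lists A" "y \<in> lists A"
  shows "pres_cong A R `` {x} \<otimes>\<^bsub>presented_monoid A R\<^esub> pres_cong A R `` {y} = pres_cong A R `` {x @ y}"
proof -
  have "congruent2 (pres_cong A R) (pres_cong A R) (\<lambda>x y. pres_cong A R `` {x @ y})"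
    by (intro congruent2I' equiv_class_eq[OF equiv_pres_cong] pres_cong.append)
  then show ?thesis
    using UN_equiv_class2[OF equiv_pres_cong equiv_pres_cong _ assms]
    by (simp add: presented_monoid_def)
qed

lemma presented_monoid_class_eq_iff:
  assumes "x \<in> lists A" "y \<in> lists A"
  shows "pres_cong A R `` {x} = pres_cong A R `` {y} \<longleftrightarrow> (x, y) \<in> pres_cong A R"
  using eq_equiv_class_iff[OF equiv_pres_cong assms] .

lemma monoid_presented_monoid: "monoid (presented_monoid A R)"
proof -
  let ?M = "presented_monoid A R"
  let ?c = "\<lambda>x. pres_cong A R `` {x}"
  have carrier: "carrier ?M = ?c ` lists A"
    by (auto simp: presented_monoid_def quotient_def)
  have one: "\<one>\<^bsub>?M\<^esub> = ?c []"
    by (simp add: presented_monoid_def)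
  have mult: "?c x \<otimes>\<^bsub>?M\<^esub> ?c y = ?c (x @ y)" if "x \<in> lists A" "y \<in> lists A" for x y
    using that by (rule presented_monoid_mult_class)
  show ?thesis
  proof (rule monoidI)
    show "\<one>\<^bsub>?M\<^esub> \<in> carrier ?M"
      unfolding carrier one by blast
  next
    fix a b assume "a \<in> carrier ?M" "b \<in> carrier ?M"
    then obtain x y where "a = ?c x" "b = ?c y" "x \<in> lists A" "y \<in> lists A"
      unfolding carrier by blast
    moreover from this have "x @ y \<in> lists A" by simp
    ultimately show "a \<otimes>\<^bsub>?M\<^esub> b \<in> carrier ?M"
      unfolding carrier using mult by blast
  next
    fix a b c assume "a \<in> carrier ?M" "b \<in> carrier ?M" "c \<in> carrier ?M"
    then obtain x y z where *: "a = ?c x" "b = ?c y" "c = ?c z"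
      and in_lists: "x \<in> lists A" "y \<in> lists A" "z \<in> lists A"
      unfolding carrier by blast
    have "x @ y \<in> lists A" "y @ z \<in> lists A" using in_lists by simp_all
    then show "a \<otimes>\<^bsub>?M\<^esub> b \<otimes>\<^bsub>?M\<^esub> c = a \<otimes>\<^bsub>?M\<^esub> (b \<otimes>\<^bsub>?M\<^esub> c)"
      unfolding * using mult in_lists by simp
  next
    fix a assume "a \<in> carrier ?M"
    then obtain x where "a = ?c x" "x \<in> lists A"
      unfolding carrier by blast
    then show "\<one>\<^bsub>?M\<^esub> \<otimes>\<^bsub>?M\<^esub> a = a" "a \<otimes>\<^bsub>?M\<^esub> \<one>\<^bsub>?M\<^esub> = a"
      unfolding one using mult[of "[]" x] mult[of x "[]"] by simp_all
  qed
qed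


section \<open>The elliptic Artin monoids\<close>

datatype generator = T int | S nat

definition elliptic_generators :: "nat \<Rightarrow> generator set" where
  "elliptic_generators n = range T \<union> S ` {1..n}"

definition braid_relation :: "generator \<Rightarrow> generator \<Rightarrow> generator list \<times> generator list" where
  "braid_relation a b = ([a, b, a], [b, a, b])"

definition commutation_relation :: "generator \<Rightarrow> generator \<Rightarrow> generator list \<times> generator list" where
  "commutation_relation a b = ([a, b], [b, a])"

definition T_relations :: "(generator list \<times> generator list) set" where
  "T_relations = {([T i, T (i - 1)], [T j, T (j - 1)]) | i j. True}"

definition D4_relations :: "(generator list \<times> generator list) set" where
  "D4_relations =
     {braid_relation (T i) (S j) | i j. j \<in> {1..4}} \<union>
     {commutation_relation (S i) (S j) | i j. i \<in> {1..4} \<and> j \<in> {1..4} \<and> i \<noteq> j} \<union>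
     T_relations"

definition elliptic_monoid_D4 :: "generator list set monoid" where
  "elliptic_monoid_D4 = presented_monoid (elliptic_generators 4) D4_relations"

text \<open>The sets of edges are only meaningful for \<open>n = 6, 7, 8\<close>; other values are junk.\<close>

definition E_edges :: "nat \<Rightarrow> nat set set" where
  "E_edges n =
     (if n = 6 then {{1, 4}, {2, 5}, {3, 6}}
      else if n = 7 then {{2, 4}, {4, 5}, {3, 6}, {6, 7}}
      else if n = 8 then {{2, 4}, {3, 5}, {5, 6}, {6, 7}, {7, 8}}
      else {})"

definition E_relations :: "nat \<Rightarrow> (generator list \<times> generator list) set" where
  "E_relations n =
     {braid_relation (T i) (S j) | i j. j \<in> {1..3}} \<union>
     {commutation_relation (T i) (S j) | i j. j \<in> {4..n}} \<union>
     T_relations \<union>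
     {braid_relation (S j) (S k) | j k. 1 \<le> j \<and> j < k \<and> k \<le> n \<and> {j, k} \<in> E_edges n} \<union>
     {commutation_relation (S j) (S k) | j k. 1 \<le> j \<and> j < k \<and> k \<le> n \<and> {j, k} \<notin> E_edges n}"

definition elliptic_monoid_E :: "nat \<Rightarrow> generator list set monoid" where
  "elliptic_monoid_E n = presented_monoid (elliptic_generators n) (E_relations n)"

lemma D4_relations_words:
  "D4_relations \<subseteq> lists (elliptic_generators 4) \<times> lists (elliptic_generators 4)"
  by (auto simp: D4_relations_def T_relations_def braid_relation_def commutation_relation_def
      elliptic_generators_def)

lemma E_relations_words:
  "3 \<le> n \<Longrightarrow> E_relations n \<subseteq> lists (elliptic_generators n) \<times> lists (elliptic_generators n)"
  by (auto simp: E_relations_def T_relations_def braid_relation_def commutation_relation_def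
      elliptic_generators_def)

end

theory Submission
  imports Defs
begin

text \<open>
  Every pair of generators \<open>a\<close>, \<open>b\<close> occurs in exactly one relation of the form
  \<open>a c(a,b) = b c(b,a)\<close>, and all relations preserve length. By induction on length, as in
  Garside's treatment of the braid monoids, \<open>a x = b y\<close> forces \<open>x = c(a,b) z\<close> and
  \<open>y = c(b,a) z\<close> for some \<open>z\<close>; the case \<open>a = b\<close> is left cancellation. The induction step
  only needs the cube condition on triples of generators. For three generators among which
  no two \<open>t\<^sub>i\<close> occur it is the one for a Coxeter diagram of type \<open>A\<^sub>1\<^sup>3\<close>, \<open>A\<^sub>1 \<times> A\<^sub>2\<close> or \<open>A\<^sub>3\<close>,
  because there are no triangles of braid relations. The remaining interesting triple is
  \<open>t\<^sub>i\<close>, \<open>t\<^sub>j\<close>, \<open>s\<close> with \<open>s\<close> braided with both, whose least common multiple is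
  \<open>\<tau> s \<tau> s = s \<tau> s \<tau>\<close> for \<open>\<tau> = t\<^sub>i t\<^sub>i\<^sub>-\<^sub>1\<close>.
\<close>

section \<open>Complemented presentations\<close>

lemma pres_cong_length:
  assumes "(x, y) \<in> pres_cong A R" and "\<And>u v. (u, v) \<in> R \<Longrightarrow> length u = length v"
  shows "length x = length y"
  using assms(1) by (induction rule: pres_cong.induct) (auto simp: assms(2))

lemma pres_cong_least:
  assumes "\<And>x y. \<lbrakk>(x, y) \<in> R; x \<in> lists A; y \<in> lists A\<rbrakk> \<Longrightarrow> (x, y) \<in> pres_cong A R'"
  shows "pres_cong A R \<subseteq> pres_cong A R'"
proof (rule subrelI)
  fix x y assume "(x, y) \<in> pres_cong A R"
  then show "(x, y) \<in> pres_cong A R'"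
  proof (induction rule: pres_cong.induct)
    case (trans x y z)
    then show ?case by (blast intro: pres_cong.trans)
  qed (simp_all add: assms pres_cong.refl pres_cong.sym pres_cong.append)
qed

text \<open>Reversing words and mapping letters swaps the factors of a concatenation, so only the
  relations need checking. This serves to turn right cancellation into left cancellation.\<close>

lemma pres_cong_anti_map:
  assumes "(x, y) \<in> pres_cong A R" and "\<And>a. a \<in> A \<Longrightarrow> f a \<in> A"
    and "\<And>u v. \<lbrakk>(u, v) \<in> R; u \<in> lists A; v \<in> lists A\<rbrakk>
      \<Longrightarrow> (map f (rev u), map f (rev v)) \<in> pres_cong A R"
  shows "(map f (rev x), map f (rev y)) \<in> pres_cong A R"
  using assms(1)
proof (induction rule: pres_cong.induct)
  case (refl x)
  then show ?case using assms(2) by (intro pres_cong.refl) auto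
next
  case (trans x y z)
  then show ?case by (blast intro: pres_cong.trans)
qed (simp_all add: assms(3) pres_cong.sym pres_cong.append)

text \<open>
  The call \<open>word_reversing c n u v\<close> pushes \<open>u\<inverse> v\<close> to the form \<open>p q\<inverse>\<close> by replacing each
  subword \<open>a\<inverse> b\<close> with \<open>(c a b) (c b a)\<inverse>\<close>, and returns \<open>(p, q)\<close>. The bound \<open>n\<close> on the
  depth of the recursion is needed since reversing need not terminate.
\<close>

fun word_reversing ::
    "('a \<Rightarrow> 'a \<Rightarrow> 'a list) \<Rightarrow> nat \<Rightarrow> 'a list \<Rightarrow> 'a list \<Rightarrow> ('a list \<times> 'a list) option" where
  "word_reversing c n [] v = Some (v, [])"
| "word_reversing c n (a # u) [] = Some ([], a # u)"
| "word_reversing c 0 (a # u) (b # v) = None"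
| "word_reversing c (Suc n) (a # u) (b # v) =
     Option.bind (word_reversing c n u (c a b)) (\<lambda>(p1, q1).
     Option.bind (word_reversing c n (c b a) v) (\<lambda>(p2, q2).
     Option.bind (word_reversing c n q1 p2) (\<lambda>(p3, q3).
     Some (p1 @ p3, q2 @ q3))))"

lemma word_reversing_Nil2 [simp]: "word_reversing c n u [] = Some ([], u)"
  by (cases u) auto

section \<open>Complements, reversing and common multiples\<close>

locale complemented_presentation =
  fixes A :: "'a set" and c :: "'a \<Rightarrow> 'a \<Rightarrow> 'a list"
  assumes c_self: "c a a = []"
    and c_lists: "\<lbrakk>a \<in> A; b \<in> A\<rbrakk> \<Longrightarrow> c a b \<in> lists A"
    and c_length: "\<lbrakk>a \<in> A; b \<in> A\<rbrakk> \<Longrightarrow> length (c a b) = length (c b a)"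
begin

text \<open>Each relation occurs in both orientations, and the case \<open>a = b\<close> is trivial
  by \<open>c_self\<close>.\<close>

definition relations :: "('a list \<times> 'a list) set" where
  "relations = {(a # c a b, b # c b a) | a b. a \<in> A \<and> b \<in> A}"

abbreviation cong :: "'a list \<Rightarrow> 'a list \<Rightarrow> bool" (infix \<open>\<simeq>\<close> 50) where
  "x \<simeq> y \<equiv> (x, y) \<in> pres_cong A relations"

lemma cong_append: "x \<simeq> y \<Longrightarrow> x' \<simeq> y' \<Longrightarrow> x @ x' \<simeq> y @ y'"
  by (rule pres_cong.append)

lemma cong_trans [trans]: "x \<simeq> y \<Longrightarrow> y \<simeq> z \<Longrightarrow> x \<simeq> z"
  by (rule pres_cong.trans)

lemma cong_lists: "x \<simeq> y \<Longrightarrow> x \<in> lists A" "x \<simeq> y \<Longrightarrow> y \<in> lists A"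
  using pres_cong_in_lists by blast+

lemma cong_append_left: "x \<simeq> y \<Longrightarrow> u \<in> lists A \<Longrightarrow> u @ x \<simeq> u @ y"
  by (intro pres_cong.append pres_cong.refl)

lemma cong_append_right: "x \<simeq> y \<Longrightarrow> u \<in> lists A \<Longrightarrow> x @ u \<simeq> y @ u"
  by (intro pres_cong.append pres_cong.refl)

lemma cong_c: "a \<in> A \<Longrightarrow> b \<in> A \<Longrightarrow> a # c a b \<simeq> b # c b a"
  using c_lists by (intro pres_cong.rel) (auto simp: relations_def)

lemma cong_length: "x \<simeq> y \<Longrightarrow> length x = length y"
  using pres_cong_length[of x y A relations] c_length by (fastforce simp: relations_def)

lemma word_reversing_ConsE:
  assumes "word_reversing c n (a # u) (b # v) = Some (p, q)"
  obtains m p1 q1 p2 q2 p3 q3 where "n = Suc m"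
    "word_reversing c m u (c a b) = Some (p1, q1)"
    "word_reversing c m (c b a) v = Some (p2, q2)"
    "word_reversing c m q1 p2 = Some (p3, q3)"
    "p = p1 @ p3" "q = q2 @ q3"
  using assms by (cases n) (auto simp: Option.bind_eq_Some_conv)

text \<open>Soundness of reversing: every replacement is an instance of \<open>cong_c\<close>. The
  tile for the first letters and the three recursive calls fill a square, whose two boundary paths
  are congruent.\<close>

lemma word_reversing_cong:
  assumes "word_reversing c n u v = Some (p, q)" "u \<in> lists A" "v \<in> lists A"
  shows "p \<in> lists A \<and> q \<in> lists A \<and> u @ p \<simeq> v @ q"
  using assms
proof (induction n arbitrary: u v p q)
  case 0
  then show ?case by (cases u; cases v) (auto intro: pres_cong.refl)
next
  case (Suc n)
  show ?case
  proof (cases "u = [] \<or> v = []")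
    case True
    then show ?thesis using Suc.prems by (auto intro: pres_cong.refl)
  next
    case False
    then obtain a u' b v' where uv: "u = a # u'" "v = b # v'"
      by (meson neq_Nil_conv)
    obtain m p1 q1 p2 q2 p3 q3 where "Suc n = Suc m"
      and r: "word_reversing c m u' (c a b) = Some (p1, q1)"
        "word_reversing c m (c b a) v' = Some (p2, q2)"
        "word_reversing c m q1 p2 = Some (p3, q3)"
      and pq: "p = p1 @ p3" "q = q2 @ q3"
      using Suc.prems(1) unfolding uv by (rule word_reversing_ConsE)
    then have [simp]: "m = n" by simp
    have A: "a \<in> A" "b \<in> A" "u' \<in> lists A" "v' \<in> lists A"
      using Suc.prems uv by auto
    note cA = c_lists[OF A(1,2)] c_lists[OF A(2,1)]
    have 1: "p1 \<in> lists A" "q1 \<in> lists A" "u' @ p1 \<simeq> c a b @ q1"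
      using Suc.IH[of u' "c a b" p1 q1] r A cA by auto
    have 2: "p2 \<in> lists A" "q2 \<in> lists A" "c b a @ p2 \<simeq> v' @ q2"
      using Suc.IH[of "c b a" v' p2 q2] r A cA by auto
    have 3: "p3 \<in> lists A" "q3 \<in> lists A" "q1 @ p3 \<simeq> p2 @ q3"
      using Suc.IH[of q1 p2 p3 q3] r 1 2 by auto
    have "[a] @ (u' @ p1) @ p3 \<simeq> [a] @ (c a b @ q1) @ p3"
      using 1 3 A by (intro cong_append_left cong_append_right) auto
    also have "[a] @ (c a b @ q1) @ p3 \<simeq> (a # c a b) @ (p2 @ q3)"
      using cong_append_left[OF 3(3), of "a # c a b"] A cA by simp
    also have "(a # c a b) @ (p2 @ q3) \<simeq> (b # c b a) @ (p2 @ q3)"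
      using cong_c[OF A(1,2)] 2 3 by (intro cong_append_right) auto
    also have "(b # c b a) @ (p2 @ q3) \<simeq> [b] @ (v' @ q2) @ q3"
      using cong_append_left[OF cong_append_right[OF 2(3)], of q3 "[b]"] A 3 by simp
    finally show ?thesis
      unfolding uv pq using 1 2 3 by simp
  qed
qed

text \<open>The length bound makes this an induction hypothesis. For \<open>a = b\<close> it says
  that a first letter cancels, as \<open>c a a = []\<close>.\<close>

definition lcm_up_to :: "nat \<Rightarrow> bool" where
  "lcm_up_to n \<longleftrightarrow> (\<forall>a x b y. length (a # x) \<le> n \<longrightarrow> a # x \<simeq> b # y \<longrightarrow>
     (\<exists>z. x \<simeq> c a b @ z \<and> y \<simeq> c b a @ z))"

lemma lcm_up_toD:
  assumes "lcm_up_to n" "length (a # x) \<le> n" "a # x \<simeq> b # y"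
  obtains z where "x \<simeq> c a b @ z" "y \<simeq> c b a @ z" "z \<in> lists A"
proof -
  from assms obtain z where z: "x \<simeq> c a b @ z" "y \<simeq> c b a @ z"
    unfolding lcm_up_to_def by blast
  then have "z \<in> lists A" using cong_lists(2)[OF z(1)] by simp
  with z that show thesis by blast
qed

text \<open>Once pairs of letters have least common multiples up to length \<open>k\<close>, the
  common multiple found by reversing is least as well: each tile splits off its factor, and since
  congruence preserves length the remaining words stay within the bound.\<close>

lemma word_reversing_divides:
  assumes "lcm_up_to k" "word_reversing c n u v = Some (p, q)"
    and "length (u @ z) \<le> k" "u @ z \<simeq> v @ z'"
  shows "\<exists>w \<in> lists A. z \<simeq> p @ w \<and> z' \<simeq> q @ w"
  using assms(2-)
proof (induction n arbitrary: u v p q z z')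
  case 0
  have A: "u @ z \<in> lists A" "v @ z' \<in> lists A"
    using cong_lists 0 by blast+
  have "u = [] \<or> v = []" using 0 by (cases u; cases v) auto
  then show ?case
  proof
    assume "u = []"
    then show ?thesis using 0 A by (intro bexI[of _ z']) (auto intro: pres_cong.refl)
  next
    assume "v = []"
    then show ?thesis using 0 A pres_cong.sym[OF 0(3)]
      by (intro bexI[of _ z]) (auto intro: pres_cong.refl)
  qed
next
  case (Suc n)
  have A: "u @ z \<in> lists A" "v @ z' \<in> lists A"
    using cong_lists Suc.prems by blast+
  consider "u = []" | "v = []" | a u' b v' where "u = a # u'" "v = b # v'"
    by (meson neq_Nil_conv)
  then show ?case
  proof cases
    case 1
    then show ?thesis using Suc.prems A by (intro bexI[of _ z']) (auto intro: pres_cong.refl)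
  next
    case 2
    then show ?thesis using Suc.prems A pres_cong.sym[OF Suc.prems(3)]
      by (intro bexI[of _ z]) (auto intro: pres_cong.refl)
  next
    case uv: (3 a u' b v')
    obtain m p1 q1 p2 q2 p3 q3 where "Suc n = Suc m"
      and r: "word_reversing c m u' (c a b) = Some (p1, q1)"
        "word_reversing c m (c b a) v' = Some (p2, q2)"
        "word_reversing c m q1 p2 = Some (p3, q3)"
      and pq: "p = p1 @ p3" "q = q2 @ q3"
      using Suc.prems(1) unfolding uv by (rule word_reversing_ConsE)
    then have [simp]: "m = n" by simp
    have AA: "a \<in> A" "b \<in> A" "u' \<in> lists A" "v' \<in> lists A"
      using A uv by auto
    note cA = c_lists[OF AA(1,2)] c_lists[OF AA(2,1)]
    from Suc.prems uv have len: "length (a # (u' @ z)) \<le> k" 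
      and eq: "a # (u' @ z) \<simeq> b # (v' @ z')" by auto
    obtain w where w: "u' @ z \<simeq> c a b @ w" "v' @ z' \<simeq> c b a @ w" "w \<in> lists A"
      using assms(1) len eq by (rule lcm_up_toD)
    have len': "length (a # (u' @ z)) = length (b # (v' @ z'))"
      using cong_length[OF eq] .
    have "length (u' @ z) \<le> k" using len by simp
    from Suc.IH[OF r(1)[simplified] this w(1)]
    obtain w1 where w1: "z \<simeq> p1 @ w1" "w \<simeq> q1 @ w1" by blast
    have "length (c b a @ w) \<le> k" using cong_length[OF w(2)] len len' by simp
    from Suc.IH[OF r(2)[simplified] this pres_cong.sym[OF w(2)]]
    obtain w2 where w2: "w \<simeq> p2 @ w2" "z' \<simeq> q2 @ w2" by blast
    have "length (q1 @ w1) \<le> k"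
      using cong_length[OF w(1)] cong_length[OF w1(2)] len by simp
    from Suc.IH[OF r(3)[simplified] this cong_trans[OF pres_cong.sym[OF w1(2)] w2(1)]]
    obtain w3 where w3: "w3 \<in> lists A" "w1 \<simeq> p3 @ w3" "w2 \<simeq> q3 @ w3" by blast
    have "p1 \<in> lists A" "q2 \<in> lists A"
      using cong_lists(2)[OF w1(1)] cong_lists(2)[OF w2(2)] by auto
    then have "z \<simeq> p1 @ (p3 @ w3)" "z' \<simeq> q2 @ (q3 @ w3)"
      using w3 by (auto intro: cong_trans[OF w1(1)] cong_trans[OF w2(2)] cong_append_left)
    then show ?thesis using w3 pq by auto
  qed
qed

text \<open>The congruent words \<open>b # c b a @ p\<close> and \<open>b # c b d @ q\<close> form a
  common multiple of \<open>a\<close>, \<open>b\<close>, \<open>d\<close>. It has to be a multiple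
  of \<open>a # c a d\<close>, with one cofactor \<open>r\<close>. The first letters
  \<open>a\<close> and \<open>d\<close> are stripped in the two congruences, so that no cancellation
  is presupposed.\<close>

definition cube :: "'a \<Rightarrow> 'a \<Rightarrow> 'a \<Rightarrow> bool" where
  "cube a b d \<longleftrightarrow> (\<exists>n p q r. word_reversing c n (c b a) (c b d) = Some (p, q) \<and>
     c a b @ p \<simeq> c a d @ r \<and> c d b @ q \<simeq> c d a @ r)"

lemma cube_degenerate:
  assumes "a \<in> A" "b \<in> A" "d \<in> A" "a = b \<or> b = d \<or> a = d"
  shows "cube a b d"
proof -
  have refl: "c x y \<simeq> c x y" if "x \<in> A" "y \<in> A" for x y
    using that by (intro pres_cong.refl c_lists)
  consider "a = b" | "b = d" | "a = d" using assms by blast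
  then show ?thesis
  proof cases
    case 1
    then show ?thesis unfolding cube_def using refl[of b d] refl[of d b] assms
      by (intro exI[of _ 0] exI[of _ "c b d"] exI[of _ "[]"]) (simp add: c_self)
  next
    case 2
    then show ?thesis unfolding cube_def using refl[of a d] refl[of d a] assms
      by (intro exI[of _ 0] exI[of _ "[]"] exI[of _ "c b a"]) (simp add: c_self)
  next
    case 3
    have "\<exists>n. word_reversing c n u u = Some ([], [])" for u
    proof (induction u)
      case (Cons x u)
      then obtain n where "word_reversing c n u u = Some ([], [])" by blast
      then show ?case by (intro exI[of _ "Suc n"]) (simp add: c_self)
    qed auto
    then obtain n where "word_reversing c n (c b d) (c b d) = Some ([], [])" by blast
    then show ?thesis unfolding cube_def using refl[of d b] 3 assms
      by (intro exI[of _ n] exI[of _ "[]"] exI[of _ "c d b"]) (simp add: c_self)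
  qed
qed

text \<open>Makes the cube condition computable: words that reverse to a pair of empty words are
  congruent, and the candidate for \<open>r\<close> comes from reversing \<open>c a b\<close>
  against \<open>c a d\<close>.\<close>

lemma cubeI:
  assumes "a \<in> A" "b \<in> A" "d \<in> A"
    and *: "case word_reversing c n (c b a) (c b d) of Some (p, q) \<Rightarrow>
      (case word_reversing c n (c a b) (c a d) of Some (_, r) \<Rightarrow>
        word_reversing c n (c a b @ p) (c a d @ r) = Some ([], []) \<and>
        word_reversing c n (c d b @ q) (c d a @ r) = Some ([], [])
      | None \<Rightarrow> False) | None \<Rightarrow> False"
  shows "cube a b d"
proof -
  obtain p q p' r where 1: "word_reversing c n (c b a) (c b d) = Some (p, q)"
    and 2: "word_reversing c n (c a b) (c a d) = Some (p', r)"
    and 3: "word_reversing c n (c a b @ p) (c a d @ r) = Some ([], [])"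
    and 4: "word_reversing c n (c d b @ q) (c d a @ r) = Some ([], [])"
    using * by (auto split: option.splits)
  have "p \<in> lists A" "q \<in> lists A" "r \<in> lists A"
    using word_reversing_cong[OF 1] word_reversing_cong[OF 2] assms(1-3) c_lists by blast+
  then have "c a b @ p \<simeq> c a d @ r" "c d b @ q \<simeq> c d a @ r"
    using assms(1-3) c_lists word_reversing_cong[OF 3] word_reversing_cong[OF 4] by auto
  then show ?thesis
    unfolding cube_def using 1 by blast
qed

end

section \<open>Cancellation from the cube condition\<close>

locale cube_presentation = complemented_presentation +
  assumes cube: "\<lbrakk>a \<in> A; b \<in> A; d \<in> A; a \<noteq> b; b \<noteq> d; a \<noteq> d\<rbrakk> \<Longrightarrow> cube a b d"
begin

text \<open>The outer induction is on length, the inner one on the derivation of the congruence.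
  Only transitivity uses the cube condition and the outer hypothesis.\<close>

lemma lcm_up_to: "lcm_up_to n"
proof (induction n)
  case 0
  then show ?case by (simp add: lcm_up_to_def)
next
  case (Suc n)
  have *: "\<exists>z \<in> lists A. x \<simeq> c a b @ z \<and> y \<simeq> c b a @ z"
    if "u \<simeq> v" "length u \<le> Suc n" "u = a # x" "v = b # y" for u v a x b y
    using that
  proof (induction arbitrary: a x b y rule: pres_cong.induct)
    case (rel u v)
    then have "x = c a b" "y = c b a" "a \<in> A" "b \<in> A" by (auto simp: relations_def)
    then show ?case using c_lists[of a b] c_lists[of b a]
      by (intro bexI[of _ "[]"]) (auto intro: pres_cong.refl)
  next
    case (refl u)
    then show ?case by (intro bexI[of _ x]) (auto simp: c_self intro: pres_cong.refl)
  next
    case (sym u v)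
    then have "length u \<le> Suc n" using cong_length[OF sym.hyps] by simp
    from sym.IH[OF this sym.prems(3,2)] show ?case by blast
  next
    case (trans u v w)
    have len: "length v = length u" "length w = length u"
      using cong_length[OF trans.hyps(1)] cong_length[OF trans.hyps(2)] by auto
    then obtain d t where v: "v = d # t" using trans.prems by (cases v) auto
    have A: "a \<in> A" "b \<in> A" "d \<in> A"
      using cong_lists[OF trans.hyps(1)] cong_lists[OF trans.hyps(2)] trans.prems v by auto
    obtain z1 where z1: "z1 \<in> lists A" "x \<simeq> c a d @ z1" "t \<simeq> c d a @ z1"
      using trans.IH(1)[OF trans.prems(1,2) v] by blast
    obtain z2 where z2: "z2 \<in> lists A" "t \<simeq> c d b @ z2" "y \<simeq> c b d @ z2"
      using trans.IH(2)[OF _ v trans.prems(3)] trans.prems(1) len by auto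
    \<comment> \<open>The letter \<open>d\<close> links the two halves of the derivation:
      \<open>t\<close> is a common multiple of \<open>c d a\<close> and \<open>c d b\<close>, hence
      a multiple of what reversing these two words yields.\<close>
    have "cube a d b" using cube[of a d b] cube_degenerate[of a d b] A by blast
    then obtain m p q r where m: "word_reversing c m (c d a) (c d b) = Some (p, q)"
      and r: "c a d @ p \<simeq> c a b @ r" "c b d @ q \<simeq> c b a @ r"
      unfolding cube_def by blast
    \<comment> \<open>Dropping \<open>d\<close> makes \<open>t\<close> shorter than
      \<open>v\<close>, so the outer hypothesis for length \<open>n\<close> applies.\<close>
    have "length (c d a @ z1) \<le> n"
      using cong_length[OF z1(3)] len v trans.prems by simp
    then obtain w where w: "w \<in> lists A" "z1 \<simeq> p @ w" "z2 \<simeq> q @ w"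
      using word_reversing_divides[OF Suc m _ cong_trans[OF pres_cong.sym[OF z1(3)] z2(2)]]
      by blast
    note z1(2)
    also have "c a d @ z1 \<simeq> c a d @ (p @ w)"
      using w A by (intro cong_append_left c_lists) auto
    also have "c a d @ (p @ w) \<simeq> c a b @ (r @ w)"
      using cong_append_right[OF r(1) w(1)] by simp
    finally have x: "x \<simeq> c a b @ (r @ w)" .
    note z2(3)
    also have "c b d @ z2 \<simeq> c b d @ (q @ w)"
      using w A by (intro cong_append_left c_lists) auto
    also have "c b d @ (q @ w) \<simeq> c b a @ (r @ w)"
      using cong_append_right[OF r(2) w(1)] by simp
    finally have y: "y \<simeq> c b a @ (r @ w)" .
    have "r @ w \<in> lists A" using cong_lists(2)[OF x] by simp
    with x y show ?case by blast
  next
    case (append u v u' v')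
    have len: "length u = length v" by (rule cong_length) fact
    have A: "u' \<in> lists A" using cong_lists append.hyps by blast
    show ?case
    proof (cases u)
      case Nil
      then have "v = []" using len by simp
      with Nil append.prems have "length u' \<le> Suc n" "u' = a # x" "v' = b # y" by auto
      then show ?thesis by (rule append.IH(2))
    next
      case (Cons a' s)
      then obtain b' t where v: "v = b' # t" using len by (cases v) auto
      from append.prems Cons v have ab: "a' = a" "b' = b" "x = s @ u'" "y = t @ v'" by auto
      have "length u \<le> Suc n" using append.prems(1) by simp
      from append.IH(1)[OF this Cons v] obtain z
        where z: "z \<in> lists A" "s \<simeq> c a b @ z" "t \<simeq> c b a @ z"
        unfolding ab by blast
      have "x \<simeq> c a b @ (z @ u')"
        using cong_append_right[OF z(2) A] ab by simp
      \<comment> \<open>One cofactor must serve both \<open>x\<close> and \<open>y\<close>, hence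
        \<open>v'\<close> is replaced by \<open>u'\<close>.\<close>
      moreover have "y \<simeq> c b a @ (z @ u')"
        using cong_append[OF z(3) pres_cong.sym[OF append.hyps(2)]] ab by simp
      ultimately show ?thesis using z A by (intro bexI[of _ "z @ u'"]) auto
    qed
  qed
  show ?case
    unfolding lcm_up_to_def
  proof (intro allI impI)
    fix a x b y assume "length (a # x) \<le> Suc n" "a # x \<simeq> b # y"
    with *[OF this(2) this(1) HOL.refl HOL.refl]
    show "\<exists>z. x \<simeq> c a b @ z \<and> y \<simeq> c b a @ z" by blast
  qed
qed

lemma left_cancel: "u @ x \<simeq> u @ y \<Longrightarrow> x \<simeq> y"
proof (induction u)
  case (Cons a u)
  then have "a # (u @ x) \<simeq> a # (u @ y)" by simp
  then obtain z where z: "u @ x \<simeq> c a a @ z" "u @ y \<simeq> c a a @ z"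
    by (rule lcm_up_toD[OF lcm_up_to order.refl])
  have "u @ x \<simeq> u @ y"
    using cong_trans[OF z(1) pres_cong.sym[OF z(2)]] .
  then show ?case by (rule Cons.IH)
qed simp

end

section \<open>From words to the presented monoid\<close>

lemma cancellative_presented_monoid:
  assumes left: "\<And>u x y. (u @ x, u @ y) \<in> pres_cong A R \<Longrightarrow> (x, y) \<in> pres_cong A R"
    and right: "\<And>u x y. (x @ u, y @ u) \<in> pres_cong A R \<Longrightarrow> (x, y) \<in> pres_cong A R"
  shows "cancellative_monoid (presented_monoid A R)"
proof -
  let ?c = "\<lambda>x. pres_cong A R `` {x}"
  have carrier: "carrier (presented_monoid A R) = ?c ` lists A"
    by (auto simp: presented_monoid_def quotient_def)
  interpret monoid "presented_monoid A R" by (rule monoid_presented_monoid)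
  show ?thesis
  proof
    fix u v v' w
    assume "u \<in> carrier (presented_monoid A R)" "v \<in> carrier (presented_monoid A R)"
      "v' \<in> carrier (presented_monoid A R)" "w \<in> carrier (presented_monoid A R)"
    then obtain x y y' z where *: "u = ?c x" "v = ?c y" "v' = ?c y'" "w = ?c z"
      and A: "x \<in> lists A" "y \<in> lists A" "y' \<in> lists A" "z \<in> lists A"
      unfolding carrier by blast
    assume eq: "u \<otimes>\<^bsub>presented_monoid A R\<^esub> v \<otimes>\<^bsub>presented_monoid A R\<^esub> w =
      u \<otimes>\<^bsub>presented_monoid A R\<^esub> v' \<otimes>\<^bsub>presented_monoid A R\<^esub> w"
    have A': "x @ y \<in> lists A" "x @ y' \<in> lists A" "(x @ y) @ z \<in> lists A" "(x @ y') @ z \<in> lists A"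
      using A by auto
    have "?c ((x @ y) @ z) = ?c ((x @ y') @ z)"
      using eq unfolding * presented_monoid_mult_class[OF A(1,2)] presented_monoid_mult_class[OF A(1,3)]
        presented_monoid_mult_class[OF A'(1) A(4)] presented_monoid_mult_class[OF A'(2) A(4)] .
    then have "((x @ y) @ z, (x @ y') @ z) \<in> pres_cong A R"
      using presented_monoid_class_eq_iff[OF A'(3,4)] by blast
    then have "(x @ y, x @ y') \<in> pres_cong A R" by (rule right)
    then have "(y, y') \<in> pres_cong A R" by (rule left)
    then show "v = v'"
      unfolding * using presented_monoid_class_eq_iff[OF A(2,3)] by blast
  qed
qed

section \<open>Elliptic Artin monoids\<close>

text \<open>
  \<open>B\<close> collects the indices \<open>j\<close> for which \<open>S j\<close> braids with every \<open>T i\<close>, and \<open>adj\<close>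
  the braided pairs among the \<open>S j\<close>; all other pairs commute.
\<close>

fun elliptic_compl ::
    "nat set \<Rightarrow> (nat \<Rightarrow> nat \<Rightarrow> bool) \<Rightarrow> generator \<Rightarrow> generator \<Rightarrow> generator list" where
  "elliptic_compl B adj (T i) (T j) = (if i = j then [] else [T (i - 1)])"
| "elliptic_compl B adj (T i) (S j) = (if j \<in> B then [S j, T i] else [S j])"
| "elliptic_compl B adj (S j) (T i) = (if j \<in> B then [T i, S j] else [T i])"
| "elliptic_compl B adj (S j) (S k) =
     (if j = k then [] else if adj j k then [S k, S j] else [S k])"

text \<open>The triangle conditions exclude three pairwise braided generators. Those would form the
  affine diagram on three nodes, where no common multiple exists, so \<open>cube\<close> would
  fail.\<close>

locale elliptic_diagram =
  fixes n :: nat and B :: "nat set" and adj :: "nat \<Rightarrow> nat \<Rightarrow> bool"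
  assumes adj_sym: "adj j k \<longleftrightarrow> adj k j"
    and no_S_triangle: "\<lbrakk>adj j k; adj k l\<rbrakk> \<Longrightarrow> \<not> adj j l"
    and no_T_triangle: "\<lbrakk>j \<in> B; k \<in> B\<rbrakk> \<Longrightarrow> \<not> adj j k"
begin

sublocale complemented_presentation "elliptic_generators n" "elliptic_compl B adj"
proof
  fix a b
  show "elliptic_compl B adj a a = []" by (cases a) auto
  assume "a \<in> elliptic_generators n" "b \<in> elliptic_generators n"
  then show "elliptic_compl B adj a b \<in> lists (elliptic_generators n)"
    by (cases a; cases b) (auto simp: elliptic_generators_def)
  show "length (elliptic_compl B adj a b) = length (elliptic_compl B adj b a)"
    using adj_sym by (cases a; cases b) auto
qed

sublocale cube_presentation "elliptic_generators n" "elliptic_compl B adj"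
proof
  fix a b d
  assume *: "a \<in> elliptic_generators n" "b \<in> elliptic_generators n" "d \<in> elliptic_generators n"
    "a \<noteq> b" "b \<noteq> d" "a \<noteq> d"
  show "cube a b d"
  proof (cases a; cases b; cases d)
    fix i j k assume "a = T i" "b = T j" "d = T k"
    \<comment> \<open>Depth 10 suffices in every case; \<open>numeral_eq_Suc\<close> unfolds it so
      that the simplifier can run the reversing.\<close>
    with * show ?thesis by (intro cubeI[where n = 10]) (simp_all add: numeral_eq_Suc)
  next
    fix i j k assume "a = T i" "b = T j" "d = S k"
    with * show ?thesis
      by (cases "k \<in> B"; intro cubeI[where n = 10]) (simp_all add: numeral_eq_Suc)
  next
    fix i j k assume "a = T i" "b = S j" "d = T k"
    with * show ?thesis
      by (cases "j \<in> B"; intro cubeI[where n = 10]) (simp_all add: numeral_eq_Suc)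
  next
    fix i j k assume "a = S i" "b = T j" "d = T k"
    with * show ?thesis
      by (cases "i \<in> B"; intro cubeI[where n = 10]) (simp_all add: numeral_eq_Suc)
  next
    fix i j k assume "a = T i" "b = S j" "d = S k"
    with * show ?thesis using no_T_triangle[of j k] adj_sym[of j k]
      by (cases "j \<in> B"; cases "k \<in> B"; cases "adj j k"; intro cubeI[where n = 10])
        (simp_all add: numeral_eq_Suc)
  next
    fix i j k assume "a = S i" "b = T j" "d = S k"
    with * show ?thesis using no_T_triangle[of i k] adj_sym[of i k]
      by (cases "i \<in> B"; cases "k \<in> B"; cases "adj i k"; intro cubeI[where n = 10])
        (simp_all add: numeral_eq_Suc)
  next
    fix i j k assume "a = S i" "b = S j" "d = T k"
    with * show ?thesis using no_T_triangle[of i j] adj_sym[of i j]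
      by (cases "i \<in> B"; cases "j \<in> B"; cases "adj i j"; intro cubeI[where n = 10])
        (simp_all add: numeral_eq_Suc)
  next
    fix i j k assume "a = S i" "b = S j" "d = S k"
    with * show ?thesis
      using no_S_triangle[of i j k] adj_sym[of i j] adj_sym[of i k] adj_sym[of j k]
      by (cases "adj i j"; cases "adj j k"; cases "adj i k"; intro cubeI[where n = 10])
        (simp_all add: numeral_eq_Suc)
  qed
qed

abbreviation elliptic_cong :: "generator list \<Rightarrow> generator list \<Rightarrow> bool" (infix \<open>\<simeq>\<close> 50) where
  "x \<simeq> y \<equiv> cong x y"

text \<open>
  Since \<open>t\<^sub>i t\<^sub>i\<^sub>-\<^sub>1\<close> read backwards becomes \<open>t\<^sub>1\<^sub>-\<^sub>i t\<^sub>-\<^sub>i\<close> under \<open>t\<^sub>i \<mapsto> t\<^sub>-\<^sub>i\<close>, this map extends to an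
  anti-automorphism, which reduces right cancellation to left cancellation.
\<close>

fun mirror :: "generator \<Rightarrow> generator" where
  "mirror (T i) = T (- i)"
| "mirror (S j) = S j"

lemma mirror_mirror: "mirror (mirror a) = a"
  by (cases a) auto

lemma mirror_generators: "a \<in> elliptic_generators n \<Longrightarrow> mirror a \<in> elliptic_generators n"
  by (cases a) (auto simp: elliptic_generators_def)

lemma mirror_relation:
  assumes "a \<in> elliptic_generators n" "b \<in> elliptic_generators n"
  shows "map mirror (rev (a # elliptic_compl B adj a b)) \<simeq>
    map mirror (rev (b # elliptic_compl B adj b a))"
proof (cases a; cases b)
  fix i j assume ab: "a = T i" "b = T j"
  have "T (1 - i) \<in> elliptic_generators n" "T (1 - j) \<in> elliptic_generators n"
    by (auto simp: elliptic_generators_def)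
  from cong_c[OF this] show ?thesis
    using ab assms by (auto intro!: pres_cong.refl split: if_splits dest: mirror_generators)
next
  fix i j assume ab: "a = T i" "b = S j"
  with assms have "T (- i) \<in> elliptic_generators n" "S j \<in> elliptic_generators n"
    using mirror_generators by force+
  from cong_c[OF this] show ?thesis
    using ab by (auto split: if_splits dest: pres_cong.sym)
next
  fix i j assume ab: "a = S j" "b = T i"
  with assms have "S j \<in> elliptic_generators n" "T (- i) \<in> elliptic_generators n"
    using mirror_generators by force+
  from cong_c[OF this] show ?thesis
    using ab by (auto split: if_splits dest: pres_cong.sym)
next
  fix i j assume ab: "a = S i" "b = S j"
  from cong_c[OF assms] show ?thesis
    using ab adj_sym[of i j] by (auto split: if_splits dest: pres_cong.sym)
qed

lemma cong_mirror: "x \<simeq> y \<Longrightarrow> map mirror (rev x) \<simeq> map mirror (rev y)"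
  by (erule pres_cong_anti_map) (auto simp: relations_def mirror_generators
      intro: mirror_relation[simplified])

lemma right_cancel:
  assumes "x @ u \<simeq> y @ u"
  shows "x \<simeq> y"
proof -
  have "map mirror (rev u) @ map mirror (rev x) \<simeq> map mirror (rev u) @ map mirror (rev y)"
    using cong_mirror[OF assms] by simp
  then have "map mirror (rev x) \<simeq> map mirror (rev y)"
    by (rule left_cancel)
  from cong_mirror[OF this] show ?thesis
    by (simp add: rev_map comp_def mirror_mirror)
qed

section \<open>Comparison with the defining relations\<close>

lemma T_relations_cong: "T_relations \<subseteq> pres_cong (elliptic_generators n) relations"
proof -
  have "[T i, T (i - 1)] \<simeq> [T j, T (j - 1)]" for i j
    \<comment> \<open>For \<open>i = j\<close> the complement is empty, and reflexivity has to
      supply the two-letter word.\<close>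
    using cong_c[of "T i" "T j"] pres_cong.refl[of "[T i, T (i - 1)]" "elliptic_generators n"]
    by (cases "i = j") (auto simp: elliptic_generators_def)
  then show ?thesis by (auto simp: T_relations_def)
qed

lemma TS_relation_cong:
  assumes "j \<in> {1..n}"
  shows "(if j \<in> B then braid_relation (T i) (S j) else commutation_relation (T i) (S j))
    \<in> pres_cong (elliptic_generators n) relations"
  using cong_c[of "T i" "S j"] assms
  by (auto simp: elliptic_generators_def braid_relation_def commutation_relation_def)

lemma SS_relation_cong:
  assumes "j \<in> {1..n}" "k \<in> {1..n}" "j \<noteq> k"
  shows "(if adj j k then braid_relation (S j) (S k) else commutation_relation (S j) (S k))
    \<in> pres_cong (elliptic_generators n) relations"
  using cong_c[of "S j" "S k"] assms adj_sym[of j k]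
  by (auto simp: elliptic_generators_def braid_relation_def commutation_relation_def)

text \<open>\<open>R\<close> may list a relation in one orientation only; the hypotheses still make
  \<open>R\<close> and \<open>relations\<close> generate the same congruence, to which
  \<open>left_cancel\<close> and \<open>right_cancel\<close> apply.\<close>

lemma cancellative:
  assumes T: "T_relations \<subseteq> R"
    and TS: "\<And>i j. j \<in> {1..n} \<Longrightarrow>
      (if j \<in> B then braid_relation (T i) (S j) else commutation_relation (T i) (S j)) \<in> R"
    and SS: "\<And>j k. \<lbrakk>1 \<le> j; j < k; k \<le> n\<rbrakk> \<Longrightarrow>
      (if adj j k then braid_relation (S j) (S k) else commutation_relation (S j) (S k)) \<in> R"
    and R: "R \<subseteq> pres_cong (elliptic_generators n) relations"
  shows "cancellative_monoid (presented_monoid (elliptic_generators n) R)"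
proof -
  let ?A = "elliptic_generators n" and ?c = "elliptic_compl B adj"
  have "(a # ?c a b, b # ?c b a) \<in> pres_cong ?A R" if ab: "a \<in> ?A" "b \<in> ?A" for a b
  proof -
    let ?l = "a # ?c a b" and ?r = "b # ?c b a"
    have l: "?l \<in> lists ?A" and r: "?r \<in> lists ?A"
      using cong_lists[OF cong_c[OF ab]] by auto
    \<comment> \<open>The hypotheses put \<open>T\<close> before \<open>S\<close> and the smaller
      index first; the third alternative covers the opposite order.\<close>
    consider "a = b" | "(?l, ?r) \<in> R" | "(?r, ?l) \<in> R"
    proof (cases a; cases b)
      fix i j assume "a = T i" "b = T j"
      then show thesis using T that(1,2) by (cases "i = j") (auto simp: T_relations_def)
    next
      fix i j assume "a = T i" "b = S j"
      then show thesis using TS[of j i] ab that(2)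
        by (auto simp: elliptic_generators_def braid_relation_def commutation_relation_def
            split: if_splits)
    next
      fix i j assume "a = S j" "b = T i"
      then show thesis using TS[of j i] ab that(3)
        by (auto simp: elliptic_generators_def braid_relation_def commutation_relation_def
            split: if_splits)
    next
      fix j k assume "a = S j" "b = S k"
      then show thesis using SS[of j k] SS[of k j] adj_sym[of j k] ab that
        by (cases j k rule: linorder_cases)
          (auto simp: elliptic_generators_def braid_relation_def commutation_relation_def
            split: if_splits)
    qed
    then show ?thesis
    proof cases
      case 1
      then show ?thesis using pres_cong.refl[OF r] by simp
    next
      case 2
      then show ?thesis using l r by (rule pres_cong.rel)
    next
      case 3
      then show ?thesis using l r by (intro pres_cong.sym[OF pres_cong.rel])
    qed
  qed
  then have "pres_cong ?A R = pres_cong ?A relations"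
    using R by (intro equalityI pres_cong_least) (auto simp: relations_def)
  then show ?thesis
    by (intro cancellative_presented_monoid) (auto dest: left_cancel right_cancel)
qed

end

section \<open>The diagrams \<open>D\<^sub>4\<close> and \<open>E\<^sub>n\<close>\<close>

lemma cancellative_D4: "cancellative_monoid elliptic_monoid_D4"
proof -
  interpret elliptic_diagram 4 "{1..4}" "\<lambda>_ _. False"
    by unfold_locales auto
  show ?thesis
    unfolding elliptic_monoid_D4_def
  proof (rule cancellative)
    show "D4_relations \<subseteq> pres_cong (elliptic_generators 4) relations"
      using TS_relation_cong SS_relation_cong T_relations_cong
      unfolding D4_relations_def by fastforce
    show "(if False then braid_relation (S j) (S k) else commutation_relation (S j) (S k))
        \<in> D4_relations" if "1 \<le> j" "j < k" "k \<le> 4" for j k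
    proof -
      have "j \<in> {1..4}" "k \<in> {1..4}" "j \<noteq> k" using that by auto
      then show ?thesis unfolding D4_relations_def by auto
    qed
  qed (auto simp: D4_relations_def)
qed

text \<open>The edges form disjoint paths; for \<open>j = l\<close> the set \<open>{j, l}\<close> is
  a singleton and thus no edge.\<close>

lemma E_edges_no_triangle:
  assumes "n \<in> {6, 7, 8}" "{j, k} \<in> E_edges n" "{k, l} \<in> E_edges n"
  shows "{j, l} \<notin> E_edges n"
  using assms by (auto simp: E_edges_def doubleton_eq_iff)

text \<open>The indices 1, 2, 3 lie on three different paths, one of which may be a single point.
  This gives \<open>no_T_triangle\<close>.\<close>

lemma E_edges_not_within_3:
  assumes "n \<in> {6, 7, 8}" "j \<in> {1..3}" "k \<in> {1..3}"
  shows "{j, k} \<notin> E_edges n"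
  using assms by (auto simp: E_edges_def doubleton_eq_iff)

lemma cancellative_E:
  assumes n: "n \<in> {6, 7, 8}"
  shows "cancellative_monoid (elliptic_monoid_E n)"
proof -
  interpret elliptic_diagram n "{1..3}" "\<lambda>j k. {j, k} \<in> E_edges n"
    using E_edges_no_triangle[OF n] E_edges_not_within_3[OF n]
    by unfold_locales (auto simp: insert_commute)
  show ?thesis
    unfolding elliptic_monoid_E_def
  proof (rule cancellative)
    have "j \<in> {1..n}" if "j \<in> {1..3}" for j
      using that n by auto
    moreover have "j \<in> {1..n}" "j \<notin> {1..3}" if "j \<in> {4..n}" for j
      using that by auto
    ultimately have TS: "braid_relation (T i) (S j) \<in> pres_cong (elliptic_generators n) relations"
      if "j \<in> {1..3}" for i j
      using that TS_relation_cong[of j i] by (auto split: if_splits)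
    have TS': "commutation_relation (T i) (S j) \<in> pres_cong (elliptic_generators n) relations"
      if "j \<in> {4..n}" for i j
      using that TS_relation_cong[of j i] by (auto split: if_splits)
    have SS: "braid_relation (S j) (S k) \<in> pres_cong (elliptic_generators n) relations"
      if "1 \<le> j" "j < k" "k \<le> n" "{j, k} \<in> E_edges n" for j k
      using that SS_relation_cong[of j k] by auto
    have SS': "commutation_relation (S j) (S k) \<in> pres_cong (elliptic_generators n) relations"
      if "1 \<le> j" "j < k" "k \<le> n" "{j, k} \<notin> E_edges n" for j k
      using that SS_relation_cong[of j k] by auto
    show "E_relations n \<subseteq> pres_cong (elliptic_generators n) relations"
      unfolding E_relations_def using T_relations_cong TS TS' SS SS' by blast
  qed (auto simp: E_relations_def)
qed

theorem theorem4p10: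
  shows "cancellative_monoid elliptic_monoid_D4 \<and>
    (\<forall>n\<in>{6, 7, 8}. cancellative_monoid (elliptic_monoid_E n))"
  using cancellative_D4 cancellative_E by blast

end
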